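(* Let $q$ be a prime power and let $n,k$ be integers with $3\le k\le n-2\le q-2$. Let $\alpha_1,\dots,\alpha_n\in\mathbb{F}_q$ be pairwise distinct. Let $C_{k-1,k-2}$ be the linear code over $\mathbb{F}_q$ generated by the $k\times n$ matrix $G_{k-1,k-2}$ whose rows are $(\alpha_1^{e},\alpha_2^{e},\dots,\alpha_n^{e})$ for $e=0,1,\dots,k-3,k,k+1$ (in this order). Then $C_{k-1,k-2}$ is an $[n,k,d]$ linear code with $d\in\{n-k-1,\,n-k,\,n-k+1\}$.
   Context: Convention: $0^0=1$. An $[n,k,d]$ code is a linear code of length $n$, dimension $k$ and minimum Hamming distance $d$. *)

theory Defs
  imports "HOL-Analysis.Analysis"
begin

text \<open>Hamming weight of a vector of length CARD('n).\<close>
definition hamming_weight :: "'a::zero ^ 'n \<Rightarrow> nat" where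
  "hamming_weight c = card {i. c $ i \<noteq> 0}"

text \<open>Minimum Hamming distance of a linear code C (a subspace): minimum weight
  of its nonzero codewords (= minimum distance between distinct codewords).\<close>
definition min_distance :: "('a::zero ^ 'n) set \<Rightarrow> nat" where
  "min_distance C = Min (hamming_weight ` (C - {0}))"

text \<open>Exponents of the rows of G_{k-1,k-2}: 0,1,...,k-3,k,k+1 (in this order).\<close>
definition gen_exps :: "nat \<Rightarrow> nat list" where
  "gen_exps k = [0..<k-2] @ [k, k+1]"

text \<open>Row j (0-based, j < k) of the k x n generator matrix G_{k-1,k-2}.\<close>
definition gen_row :: "('n \<Rightarrow> 'a::field) \<Rightarrow> nat \<Rightarrow> nat \<Rightarrow> 'a ^ 'n" where
  "gen_row \<alpha> k j = (\<chi> i. \<alpha> i ^ (gen_exps k ! j))"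

text \<open>The code C_{k-1,k-2}: the row space of G_{k-1,k-2}.\<close>
definition code_C :: "('n \<Rightarrow> 'a::field) \<Rightarrow> nat \<Rightarrow> ('a ^ 'n) set" where
  "code_C \<alpha> k = vec.span (gen_row \<alpha> k ` {..<k})"

end

theory Submission
  imports Defs "HOL-Computational_Algebra.Polynomial"
begin

text \<open>Every codeword is the evaluation vector \<open>(f(\<alpha>\<^sub>1), \<dots>, f(\<alpha>\<^sub>n))\<close> of a
  polynomial \<open>f\<close> in the span of the monomials \<open>x\<^sup>e\<close>, \<open>e \<in> {0, \<dots>, k-3, k, k+1}\<close>.
  So \<open>deg f \<le> k+1\<close>, and a nonzero codeword has at most \<open>k+1\<close> zero coordinates, whence
  \<open>d \<ge> n-k-1\<close>. As \<open>k+1 < n\<close>, such an \<open>f\<close> vanishing at all \<open>\<alpha>\<^sub>i\<close> is zero, so the \<open>k\<close>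
  rows are independent. The Singleton bound gives \<open>d \<le> n-k+1\<close>.\<close>

definition poly_vec :: "('n \<Rightarrow> 'a::comm_semiring_0) \<Rightarrow> 'a poly \<Rightarrow> 'a ^ 'n" where
  "poly_vec \<alpha> p = (\<chi> i. poly p (\<alpha> i))"

definition power_row :: "('n \<Rightarrow> 'a::comm_semiring_1) \<Rightarrow> nat \<Rightarrow> 'a ^ 'n" where
  "power_row \<alpha> e = (\<chi> i. \<alpha> i ^ e)"

lemma poly_vec_0 [simp]: "poly_vec \<alpha> 0 = 0"
  by (simp add: poly_vec_def vec_eq_iff)

lemma poly_vec_add: "poly_vec \<alpha> (p + q) = poly_vec \<alpha> p + poly_vec \<alpha> q"
  by (simp add: poly_vec_def vec_eq_iff)

lemma poly_vec_diff:
  fixes \<alpha> :: "'n::finite \<Rightarrow> 'a::comm_ring"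
  shows "poly_vec \<alpha> (p - q) = poly_vec \<alpha> p - poly_vec \<alpha> q"
  by (simp add: poly_vec_def vec_eq_iff)

lemma poly_vec_sum: "poly_vec \<alpha> (\<Sum>x\<in>A. f x) = (\<Sum>x\<in>A. poly_vec \<alpha> (f x))"
  by (induction A rule: infinite_finite_induct) (simp_all add: poly_vec_add)

lemma poly_vec_monom: "poly_vec \<alpha> (monom c e) = c *s power_row \<alpha> e"
  by (simp add: poly_vec_def power_row_def poly_monom vec_eq_iff)

lemma card_vanishing_points_le_degree:
  fixes \<alpha> :: "'n::finite \<Rightarrow> 'a::idom"
  assumes "inj \<alpha>" and "p \<noteq> 0"
  shows "card {i. poly p (\<alpha> i) = 0} \<le> degree p"
proof -
  have "card {i. poly p (\<alpha> i) = 0} \<le> card {x. poly p x = 0}"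
    using assms by (intro card_inj_on_le[of \<alpha>]) (auto intro: inj_on_subset poly_roots_finite)
  also have "\<dots> \<le> degree p"
    by (rule card_poly_roots_bound[OF assms(2)])
  finally show ?thesis .
qed

lemma hamming_weight_poly_vec_ge:
  fixes \<alpha> :: "'n::finite \<Rightarrow> 'a::idom"
  assumes "inj \<alpha>" and "p \<noteq> 0"
  shows "CARD('n) - degree p \<le> hamming_weight (poly_vec \<alpha> p)"
proof -
  have "{i. poly_vec \<alpha> p $ i \<noteq> 0} = UNIV - {i. poly p (\<alpha> i) = 0}"
    by (auto simp: poly_vec_def)
  then have "hamming_weight (poly_vec \<alpha> p) = CARD('n) - card {i. poly p (\<alpha> i) = 0}"
    by (simp add: hamming_weight_def card_Diff_subset)
  with card_vanishing_points_le_degree[OF assms] show ?thesis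
    by linarith
qed

lemma poly_vec_eq_0_iff:
  fixes \<alpha> :: "'n::finite \<Rightarrow> 'a::idom"
  assumes "inj \<alpha>" and "degree p < CARD('n)"
  shows "poly_vec \<alpha> p = 0 \<longleftrightarrow> p = 0"
proof
  assume "poly_vec \<alpha> p = 0"
  then have "{i. poly p (\<alpha> i) = 0} = UNIV"
    by (auto simp: poly_vec_def vec_eq_iff)
  with card_vanishing_points_le_degree[OF assms(1)] assms(2) show "p = 0"
    by fastforce
qed simp

lemma span_power_rows_obtain_poly:
  fixes \<alpha> :: "'n::finite \<Rightarrow> 'a::field"
  assumes "v \<in> vec.span (power_row \<alpha> ` E)" and "\<forall>e\<in>E. e \<le> d"
  obtains p where "degree p \<le> d" and "v = poly_vec \<alpha> p"
proof -
  from assms(1) have "\<exists>p. degree p \<le> d \<and> v = poly_vec \<alpha> p"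
  proof (induction rule: vec.span_induct_alt)
    case base
    show ?case by (intro exI[of _ 0]) simp
  next
    case (step c x y)
    then obtain e q where "e \<in> E" "x = power_row \<alpha> e" "degree q \<le> d" "y = poly_vec \<alpha> q"
      by blast
    moreover have "degree (monom c e + q) \<le> d"
      using assms(2) \<open>e \<in> E\<close> \<open>degree q \<le> d\<close>
      by (intro degree_add_le order.trans[OF degree_monom_le]) auto
    ultimately show ?case
      by (intro exI[of _ "monom c e + q"]) (simp add: poly_vec_add poly_vec_monom)
  qed
  with that show ?thesis by blast
qed

lemma hamming_weight_span_power_rows_ge:
  fixes \<alpha> :: "'n::finite \<Rightarrow> 'a::field"
  assumes "inj \<alpha>" and "\<forall>e\<in>E. e \<le> d"
    and "v \<in> vec.span (power_row \<alpha> ` E)" and "v \<noteq> 0"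
  shows "CARD('n) - d \<le> hamming_weight v"
proof -
  obtain p where p: "degree p \<le> d" "v = poly_vec \<alpha> p"
    using span_power_rows_obtain_poly[OF assms(3,2)] .
  with assms(4) have "p \<noteq> 0" by auto
  with hamming_weight_poly_vec_ge[OF assms(1)] p show ?thesis
    by fastforce
qed

lemma inj_on_power_row:
  fixes \<alpha> :: "'n::finite \<Rightarrow> 'a::field"
  assumes "inj \<alpha>" and "\<forall>e\<in>E. e < CARD('n)"
  shows "inj_on (power_row \<alpha>) E"
proof (rule inj_onI)
  fix e e' assume "e \<in> E" "e' \<in> E" "power_row \<alpha> e = power_row \<alpha> e'"
  then have "poly_vec \<alpha> (monom 1 e - monom 1 e') = 0"
    by (simp add: poly_vec_diff poly_vec_monom)
  moreover have "degree (monom 1 e - monom (1::'a) e') < CARD('n)"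
    using assms(2) \<open>e \<in> E\<close> \<open>e' \<in> E\<close> degree_diff_le_max[of "monom (1::'a) e" "monom 1 e'"]
    by (simp add: degree_monom_eq le_less_trans)
  ultimately have "monom (1::'a) e = monom 1 e'"
    using poly_vec_eq_0_iff[OF assms(1)] by simp
  then show "e = e'"
    by (simp add: monom_eq_iff')
qed

lemma independent_power_rows:
  fixes \<alpha> :: "'n::finite \<Rightarrow> 'a::field"
  assumes "inj \<alpha>" and "\<forall>e\<in>E. e < CARD('n)"
  shows "vec.independent (power_row \<alpha> ` E)"
proof -
  have "finite E"
    using assms(2) by (auto intro: finite_subset[of E "{..<CARD('n)}"])
  show ?thesis
  proof (rule vec.independent_if_scalars_zero)
    show "finite (power_row \<alpha> ` E)"
      using \<open>finite E\<close> by simp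
  next
    fix u x assume sum_0: "(\<Sum>x\<in>power_row \<alpha> ` E. u x *s x) = 0" and "x \<in> power_row \<alpha> ` E"
    then obtain e where "e \<in> E" and x: "x = power_row \<alpha> e" by blast
    define p where "p = (\<Sum>e\<in>E. monom (u (power_row \<alpha> e)) e)"
    have "poly_vec \<alpha> p = 0"
      using sum_0 by (simp add: p_def poly_vec_sum poly_vec_monom
          sum.reindex[OF inj_on_power_row[OF assms]])
    moreover have "degree p < CARD('n)"
      unfolding p_def
    proof (rule degree_sum_less)
      fix e assume "e \<in> E"
      then show "degree (monom (u (power_row \<alpha> e)) e) < CARD('n)"
        using assms(2) degree_monom_le le_less_trans by blast
    qed simp
    ultimately have "p = 0"
      using poly_vec_eq_0_iff[OF assms(1)] by simp
    then have "coeff p e = 0" by simp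
    moreover have "coeff p e = u x"
      using \<open>e \<in> E\<close> \<open>finite E\<close> by (simp add: p_def x coeff_sum)
    ultimately show "u x = 0" by simp
  qed
qed

lemma dim_power_rows:
  fixes \<alpha> :: "'n::finite \<Rightarrow> 'a::field"
  assumes "inj \<alpha>" and "\<forall>e\<in>E. e < CARD('n)"
  shows "vec.dim (power_row \<alpha> ` E) = card E"
  using vec.dim_span_eq_card_independent[OF independent_power_rows[OF assms]]
    card_image[OF inj_on_power_row[OF assms]] by simp

lemma singleton_bound:
  fixes S :: "('a::field ^ 'n::finite) set"
  assumes "0 < vec.dim S"
  shows "\<exists>w\<in>vec.span S - {0}. hamming_weight w + vec.dim S \<le> CARD('n) + 1"
proof -
  have "vec.dim S - 1 \<le> CARD('n)"
    using dim_subset_UNIV_cart_gen[of S] by linarith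
  then obtain T :: "'n set" where T: "card T = vec.dim S - 1"
    by (meson obtain_subset_with_card_n)
  \<comment> \<open>The projection onto \<open>dim S - 1\<close> coordinates cannot be injective on \<open>span S\<close>.\<close>
  define f :: "'a ^ 'n \<Rightarrow> 'a ^ 'n" where "f w = (\<chi> i. if i \<in> T then w $ i else 0)" for w
  have "Vector_Spaces.linear (*s) (*s) f"
    by (auto simp: Vector_Spaces.linear_iff vec.vector_space_axioms f_def vec_eq_iff)
  have "f w = (\<Sum>i\<in>T. (w $ i) *s axis i 1)" for w
    by (simp add: f_def vec_eq_iff axis_def cond_component if_distrib[of "\<lambda>x. _ * x"] cong: if_cong)
  then have "f ` S \<subseteq> vec.span ((\<lambda>i. axis i (1::'a)) ` T)"
    by (auto intro!: vec.span_sum vec.span_scale intro: vec.span_base)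
  then have "vec.dim (f ` S) \<le> card ((\<lambda>i. axis i (1::'a)) ` T)"
    by (rule vec.dim_le_card) simp
  also have "\<dots> < vec.dim S"
    using T assms card_image_le[OF finite[of T], of "\<lambda>i. axis i (1::'a)"] by linarith
  finally have "\<not> inj_on f (vec.span S)"
    using vec.dim_image_eq[OF \<open>Vector_Spaces.linear (*s) (*s) f\<close>] by auto
  then obtain x y where xy: "x \<in> vec.span S" "y \<in> vec.span S" "x \<noteq> y" "f x = f y"
    unfolding inj_on_def by blast
  define w where "w = x - y"
  have w: "w \<in> vec.span S - {0}"
    using xy by (auto simp: w_def vec.span_diff)
  have "w $ i = 0" if "i \<in> T" for i
    using arg_cong[of _ _ "\<lambda>v. v $ i", OF xy(4)] that by (simp add: w_def f_def)
  then have "{i. w $ i \<noteq> 0} \<subseteq> UNIV - T"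
    by blast
  then have "hamming_weight w \<le> CARD('n) - card T"
    unfolding hamming_weight_def by (metis card_Diff_subset card_mono finite subset_UNIV)
  with w T assms dim_subset_UNIV_cart_gen[of S] show ?thesis by (intro bexI[of _ w]) auto
qed

lemma hamming_weight_le_card: "hamming_weight (w :: 'a::zero ^ 'n::finite) \<le> CARD('n)"
  unfolding hamming_weight_def by (rule card_mono) auto

lemma finite_hamming_weights: "finite (hamming_weight ` (C :: ('a::zero ^ 'n::finite) set))"
  using hamming_weight_le_card by (auto intro: finite_subset[of _ "{..CARD('n)}"])

lemma min_distance_le:
  fixes C :: "('a::zero ^ 'n::finite) set"
  assumes "w \<in> C - {0}"
  shows "min_distance C \<le> hamming_weight w"
  unfolding min_distance_def using assms finite_hamming_weights by (intro Min_le) auto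

lemma min_distance_ge:
  fixes C :: "('a::zero ^ 'n::finite) set"
  assumes "C - {0} \<noteq> {}" and "\<And>w. w \<in> C - {0} \<Longrightarrow> d \<le> hamming_weight w"
  shows "d \<le> min_distance C"
  unfolding min_distance_def using assms by (subst Min_ge_iff) (auto simp: finite_hamming_weights)

lemma card_set_gen_exps: "2 \<le> k \<Longrightarrow> card (set (gen_exps k)) = k"
  by (simp add: gen_exps_def)

lemma set_gen_exps_le: "e \<in> set (gen_exps k) \<Longrightarrow> e \<le> k + 1"
  by (auto simp: gen_exps_def)

lemma code_C_eq_span_power_rows:
  assumes "2 \<le> k"
  shows "code_C \<alpha> k = vec.span (power_row \<alpha> ` set (gen_exps k))"
proof -
  have "set (gen_exps k) = (\<lambda>j. gen_exps k ! j) ` {..<k}"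
    using assms by (auto simp: set_conv_nth gen_exps_def)
  then show ?thesis
    by (simp add: code_C_def gen_row_def power_row_def image_image)
qed

theorem theorem3p1:
  fixes \<alpha> :: "'n::finite \<Rightarrow> 'a::{finite,field}"
    and n k q :: nat
  assumes "q = CARD('a)" and "n = CARD('n)"
    and "3 \<le> k" and "k \<le> n - 2" and "n - 2 \<le> q - 2"
    and "inj \<alpha>"
  shows "vec.dim (code_C \<alpha> k) = k \<and>
         min_distance (code_C \<alpha> k) \<in> {n - k - 1, n - k, n - k + 1}"
proof -
  let ?E = "set (gen_exps k)"
  have C: "code_C \<alpha> k = vec.span (power_row \<alpha> ` ?E)"
    using assms(3) by (intro code_C_eq_span_power_rows) simp
  have E_le: "\<forall>e\<in>?E. e \<le> k + 1"
    using set_gen_exps_le by blast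
  then have "\<forall>e\<in>?E. e < CARD('n)"
    using assms(2,3,4) by force
  then have dim: "vec.dim (power_row \<alpha> ` ?E) = k"
    using assms(3) by (simp add: dim_power_rows[OF assms(6)] card_set_gen_exps)
  obtain w where w: "w \<in> code_C \<alpha> k - {0}" "hamming_weight w + k \<le> n + 1"
    using singleton_bound[of "power_row \<alpha> ` ?E"] dim assms(2,3) unfolding C by auto
  have "min_distance (code_C \<alpha> k) \<le> n - k + 1"
    using min_distance_le[OF w(1)] w(2) by linarith
  moreover have "n - k - 1 \<le> min_distance (code_C \<alpha> k)"
  proof (rule min_distance_ge)
    fix v assume "v \<in> code_C \<alpha> k - {0}"
    then show "n - k - 1 \<le> hamming_weight v"
      using hamming_weight_span_power_rows_ge[OF assms(6) E_le, of v] C assms(2) by auto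
  qed (use w in blast)
  ultimately show ?thesis
    using dim unfolding C by auto
qed

end
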